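(* Let $d\ge 2$, let $p\equiv 1\pmod d$ be a prime and let $\lambda\in\mathbb{F}_p^*$. Then: (1) $MSD_d(\lambda,\mathbb{F}_p)\le\sqrt{(p-1)/d}+1$; moreover, if $\lambda$ is a $d$-th power in $\mathbb{F}_p^*$, then $MSD_d(\lambda,\mathbb{F}_p)\le\sqrt{\frac{p-1}{d}-\frac34}+\frac12$. (2) $MD_d(\lambda,\mathbb{F}_p)\le\sqrt{2(p-1)/d}+4$.
   Context: $S_d=\{x^d:x\in\mathbb{F}_p^*\}$. A set of distinct elements $a_1,\dots,a_m$ of $\mathbb{F}_p^*$ has property $D_d(\lambda,\mathbb{F}_p)$ if $a_ia_j+\lambda\in S_d\cup\{0\}$ whenever $i\ne j$, and property $SD_d(\lambda,\mathbb{F}_p)$ if $a_ia_j+\lambda\in S_d\cup\{0\}$ for all $i,j$ (including $i=j$). $MD_d(\lambda,\mathbb{F}_p)$, $MSD_d(\lambda,\mathbb{F}_p)$ are the maximum sizes of subsets of $\mathbb{F}_p^*$ with these respective properties. *)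

theory Defs
  imports Complex_Main "HOL-Number_Theory.Cong" "Berlekamp_Zassenhaus.Finite_Field"
begin

text \<open>
  The prime field \<open>\<bbbF>\<^sub>p\<close> is the type \<open>'p mod_ring\<close> with \<open>'p\<close> of class \<open>prime_card\<close>
  and \<open>p = CARD('p)\<close>.
\<close>

definition dth_powers :: "nat \<Rightarrow> 'p::prime_card mod_ring set" where
  "dth_powers d = {x ^ d | x. x \<noteq> 0}"

definition D_prop :: "nat \<Rightarrow> 'p::prime_card mod_ring \<Rightarrow> 'p mod_ring set \<Rightarrow> bool" where
  "D_prop d lam A \<longleftrightarrow>
     A \<subseteq> UNIV - {0} \<and>
     (\<forall>a\<in>A. \<forall>b\<in>A. a \<noteq> b \<longrightarrow> a * b + lam \<in> dth_powers d \<union> {0})"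

definition SD_prop :: "nat \<Rightarrow> 'p::prime_card mod_ring \<Rightarrow> 'p mod_ring set \<Rightarrow> bool" where
  "SD_prop d lam A \<longleftrightarrow>
     A \<subseteq> UNIV - {0} \<and>
     (\<forall>a\<in>A. \<forall>b\<in>A. a * b + lam \<in> dth_powers d \<union> {0})"

text \<open>
  The sets below are finite and contain \<open>0\<close> (take \<open>A = {}\<close>), so \<open>Max\<close> is well defined.
\<close>

definition MD :: "nat \<Rightarrow> 'p::prime_card mod_ring \<Rightarrow> nat" where
  "MD d lam = Max {card A | A. D_prop d lam A}"

definition MSD :: "nat \<Rightarrow> 'p::prime_card mod_ring \<Rightarrow> nat" where
  "MSD d lam = Max {card A | A. SD_prop d lam A}"

end

theory Submission
  imports Defs
begin

text \<open>
  Stepanov's method, with \<open>k = (p - 1) / d\<close>. If \<open>a b + \<lambda>\<close> is a \<open>d\<close>-th power, then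
  \<open>(a b + \<lambda>)\<^sup>k\<close> is \<open>1\<close>. For a set \<open>A\<close> of \<open>s + t + 2\<close> points let \<open>c\<^sub>a\<close> be weights such that
  \<open>\<Sum>a\<in>A. c\<^sub>a P(a) = 0\<close> for all polynomials \<open>P\<close> of degree at most \<open>s + t\<close>. The auxiliary polynomial
  \<open>\<Sum>a\<in>A. c\<^sub>a (a x + \<lambda>)\<^bsup>k+s\<^esup> (x - a)\<^sup>t\<close> has degree at most \<open>k + s + t\<close>. It vanishes to order
  \<open>s + 1\<close> at \<open>0\<close>, and to order about \<open>s\<close> at every \<open>b\<close> with \<open>a b + \<lambda> \<in> S\<^sub>d \<union> {0}\<close> for all \<open>a\<in>A\<close>, because
  there the factors \<open>(a b + \<lambda>)\<^sup>k\<close> drop out of the Taylor coefficients. The factor \<open>(x - a)\<^sup>t\<close> removes,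
  up to order \<open>t\<close>, the condition on the pair \<open>a = b\<close>. Comparing zeros with the degree for \<open>t = 0\<close> gives
  the bounds on \<open>MSD\<close> (adjoining \<open>0\<close> to \<open>A\<close> when \<open>\<lambda>\<close> is itself a \<open>d\<close>-th power), and for
  \<open>s = t\<close> the bound on \<open>MD\<close>.
\<close>

section \<open>Polynomial tools: Taylor coefficients, divided differences, orders of zeros\<close>

lemma coeff_linear_power:
  fixes a b :: "'a::comm_semiring_1"
  shows "coeff ([:a, b:] ^ n) i = of_nat (n choose i) * b ^ i * a ^ (n - i)"
proof (cases "i \<le> n")
  case False
  have "degree ([:a, b:] ^ n) \<le> 1 * n"
    by (rule order_trans[OF degree_power_le]) (simp add: degree_pCons_eq_if)
  with False show ?thesis by (simp add: coeff_eq_0 binomial_eq_0)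
qed (rule coeff_linear_poly_power)

text \<open>The weighted sum is the divided difference at the points of \<open>A\<close>.\<close>

lemma ex_weights_top_coeff:
  fixes A :: "'a::field set"
  assumes "finite A" "A \<noteq> {}"
  shows "\<exists>c. \<forall>P. degree P < card A \<longrightarrow> (\<Sum>a\<in>A. c a * poly P a) = coeff P (card A - 1)"
proof -
  \<comment> \<open>\<open>L a\<close> is a monic multiple of the Lagrange basis polynomial and
    \<open>c a\<close> normalises its value at \<open>a\<close> to 1. The claim compares top
    coefficients in the interpolation formula for \<open>P\<close>.\<close>
  define L where "L a = (\<Prod>b\<in>A - {a}. [:- b, 1:])" for a
  define c where "c a = inverse (\<Prod>b\<in>A - {a}. a - b)" for a
  have deg: "degree (L a) = card A - 1" if "a \<in> A" for a
    unfolding L_def using that assms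
    by (subst degree_prod_eq_sum_degree) auto
  have "lead_coeff (L a) = 1" for a
    unfolding L_def by (subst lead_coeff_prod) simp
  with deg have lead: "coeff (L a) (card A - 1) = 1" if "a \<in> A" for a
    using that by metis
  have card_pos: "card A > 0"
    using assms by (simp add: card_gt_0_iff)
  have "(\<Sum>a\<in>A. c a * poly P a) = coeff P (card A - 1)" if P: "degree P < card A" for P
  proof -
    have "P = (\<Sum>a\<in>A. smult (c a * poly P a) (L a))"
    proof (rule poly_eqI_degree[of A])
      fix x assume x: "x \<in> A"
      have "poly (\<Sum>a\<in>A. smult (c a * poly P a) (L a)) x = (\<Sum>a\<in>A. c a * poly P a * poly (L a) x)"
        by (simp add: poly_sum)
      also have "\<dots> = (\<Sum>a\<in>A. if a = x then poly P x else 0)"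
      proof (rule sum.cong)
        fix a assume a: "a \<in> A"
        show "c a * poly P a * poly (L a) x = (if a = x then poly P x else 0)"
          using a x assms by (auto simp: L_def c_def poly_prod field_simps)
      qed simp
      finally show "poly P x = poly (\<Sum>a\<in>A. smult (c a * poly P a) (L a)) x"
        using x assms by simp
    next
      show "degree (\<Sum>a\<in>A. smult (c a * poly P a) (L a)) < card A"
        using deg card_pos
        by (intro degree_sum_less) (auto intro!: le_less_trans[OF degree_smult_le])
    qed (rule P)
    then have "coeff P (card A - 1) = coeff (\<Sum>a\<in>A. smult (c a * poly P a) (L a)) (card A - 1)"
      by simp
    also have "\<dots> = (\<Sum>a\<in>A. c a * poly P a)"
      using lead by (simp add: coeff_sum)
    finally show ?thesis ..
  qed
  then show ?thesis by blast
qed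

lemma order_ge_if_coeff_pcompose_eq_0:
  fixes f :: "'a::idom poly"
  assumes "f \<noteq> 0" "\<And>l. l < r \<Longrightarrow> coeff (f \<circ>\<^sub>p [:b, 1:]) l = 0"
  shows "r \<le> order b f"
proof -
  from assms(2) have "monom 1 r dvd f \<circ>\<^sub>p [:b, 1:]"
    by (simp add: monom_1_dvd_iff')
  then obtain q where q: "f \<circ>\<^sub>p [:b, 1:] = monom 1 r * q" ..
  have "f = (f \<circ>\<^sub>p [:b, 1:]) \<circ>\<^sub>p [:- b, 1:]"
    by (simp add: pcompose_assoc[symmetric] pcompose_pCons)
  also have "\<dots> = [:- b, 1:] ^ r * (q \<circ>\<^sub>p [:- b, 1:])"
    unfolding q by (simp add: pcompose_mult monom_altdef pcompose_pCons pcompose_hom.hom_power)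
  finally have "[:- b, 1:] ^ r dvd f" by (metis dvd_triv_left)
  with assms(1) show ?thesis by (simp add: order_divides)
qed

lemma sum_order_le_degree_on:
  fixes f :: "'a::idom poly"
  assumes "f \<noteq> 0" "finite B"
  shows "(\<Sum>b\<in>B. order b f) \<le> degree f"
proof -
  have "(\<Sum>b\<in>B. order b f) = (\<Sum>b\<in>B \<inter> {b. poly f b = 0}. order b f)"
    using assms by (intro sum.mono_neutral_right) (auto simp: order_root)
  also have "\<dots> \<le> (\<Sum>b | poly f b = 0. order b f)"
    using poly_roots_finite[OF assms(1)] by (intro sum_mono2) auto
  also have "\<dots> \<le> degree f"
    by (rule sum_order_le_degree[OF assms(1)])
  finally show ?thesis .
qed

section \<open>The auxiliary polynomial\<close>

text \<open>Taylor coefficients below the claimed order combine divided differences of polynomials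
  in \<open>a\<close> of degree at most \<open>s + t\<close>, which vanish. A pair
  \<open>a = b\<close> may limit the order to \<open>t\<close>, a zero of \<open>a * b + lam\<close>
  to \<open>s\<close>. Up to a nonzero factor, the binomial is the coefficient of
  \<open>x ^ (s + 1)\<close> in \<open>f\<close>, whence \<open>f\<close> is not 0.\<close>

lemma ex_stepanov_polynomial:
  fixes A :: "'a::field set" and lam :: 'a
  assumes fin: "finite A" and card: "card A = s + t + 2" and lam: "lam \<noteq> 0"
    and binom: "(of_nat ((k + s) choose (s + 1)) :: 'a) \<noteq> 0"
  shows "\<exists>f. f \<noteq> 0 \<and> degree f \<le> k + s + t \<and> s + 1 \<le> order 0 f \<and>
    (\<forall>b r. r \<le> s + 1 \<longrightarrow>
      (\<forall>a\<in>A. a = b \<and> r \<le> t \<or> (a * b + lam) ^ k = 1 \<or> a * b + lam = 0 \<and> r \<le> s) \<longrightarrow>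
      r \<le> order b f)"
proof -
  have "A \<noteq> {}" using card by auto
  with ex_weights_top_coeff[OF fin] card obtain c where
    c: "\<And>P. degree P < s + t + 2 \<Longrightarrow> (\<Sum>a\<in>A. c a * poly P a) = coeff P (s + t + 1)"
    by auto
  have c0: "(\<Sum>a\<in>A. c a * poly P a) = 0" if "degree P \<le> s + t" for P
    using c[of P] that by (simp add: coeff_eq_0)
  define F where "F a = [:lam, a:] ^ (k + s) * [:- a, 1:] ^ t" for a
  define f where "f = (\<Sum>a\<in>A. smult (c a) (F a))"
  \<comment> \<open>Degree \<open>h\<close> is taken from the first factor of \<open>F a\<close>,
    shifted to \<open>b\<close>, and \<open>l - h\<close> from the second. If
    \<open>l - h > t\<close>, so that the exponent truncates, \<open>t choose (l - h)\<close> is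
    0.\<close>
  define M where "M b l h =
    (\<Sum>a\<in>A. c a * (a ^ h * (a * b + lam) ^ (k + s - h) * (b - a) ^ (t - (l - h))))" for b l h
  have F_shift: "F a \<circ>\<^sub>p [:b, 1:] = [:a * b + lam, a:] ^ (k + s) * [:b - a, 1:] ^ t" for a b
    by (simp add: F_def pcompose_mult pcompose_hom.hom_power pcompose_pCons algebra_simps)
  have coeff_f: "coeff (f \<circ>\<^sub>p [:b, 1:]) l =
      (\<Sum>h\<le>l. of_nat ((k + s) choose h) * of_nat (t choose (l - h)) * M b l h)" for b l
  proof -
    have "coeff (f \<circ>\<^sub>p [:b, 1:]) l = (\<Sum>a\<in>A. c a * coeff (F a \<circ>\<^sub>p [:b, 1:]) l)"
      by (simp add: f_def pcompose_sum pcompose_smult coeff_sum)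
    also have "\<dots> = (\<Sum>a\<in>A. \<Sum>h\<le>l. of_nat ((k + s) choose h) * of_nat (t choose (l - h)) *
        (c a * (a ^ h * (a * b + lam) ^ (k + s - h) * (b - a) ^ (t - (l - h)))))"
      by (simp add: F_shift coeff_mult coeff_linear_power sum_distrib_left) (simp add: mult_ac)
    also have "\<dots> = (\<Sum>h\<le>l. of_nat ((k + s) choose h) * of_nat (t choose (l - h)) * M b l h)"
      by (subst sum.swap) (simp add: M_def sum_distrib_left)
    finally show ?thesis .
  qed

  have M_at_0: "M 0 l h = lam ^ (k + s - h) * (- 1) ^ (t - (l - h)) *
      (\<Sum>a\<in>A. c a * poly (monom 1 (h + (t - (l - h)))) a)" for l h
  proof -
    have "(0 - a) ^ u = (- 1) ^ u * a ^ u" for a :: 'a and u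
      by (simp add: power_minus[of a])
    then show ?thesis
      by (simp only: M_def sum_distrib_left poly_monom power_add mult_zero_right add_0_left
          mult_1_left mult_ac)
  qed
  \<comment> \<open>For \<open>l - h \<le> t\<close> the monomial has degree
    \<open>t + 2 * h - l\<close>, at most \<open>t + l\<close>.\<close>
  have vanish_0: "coeff (f \<circ>\<^sub>p [:0, 1:]) l = 0" if "l \<le> s" for l
    unfolding coeff_f
  proof (rule sum.neutral, rule ballI)
    fix h assume "h \<in> {..l}"
    with that show "of_nat ((k + s) choose h) * of_nat (t choose (l - h)) * M 0 l h = 0"
      by (cases "l - h \<le> t") (auto simp: M_at_0 c0 degree_monom_eq binomial_eq_0)
  qed

  \<comment> \<open>Only \<open>h = s + 1\<close> reaches degree \<open>s + t + 1\<close>, where the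
    weighted sum is 1.\<close>
  have "coeff (f \<circ>\<^sub>p [:0, 1:]) (s + 1) =
      of_nat ((k + s) choose (s + 1)) * of_nat (t choose 0) * M 0 (s + 1) (s + 1)"
  proof -
    have "of_nat ((k + s) choose h) * of_nat (t choose (s + 1 - h)) * M 0 (s + 1) h = 0"
      if "h \<le> s" for h
      using that
      by (cases "s + 1 - h \<le> t") (auto simp: M_at_0 c0 degree_monom_eq binomial_eq_0)
    then have "(\<Sum>h\<le>s. of_nat ((k + s) choose h) * of_nat (t choose (s + 1 - h)) * M 0 (s + 1) h) = 0"
      by (intro sum.neutral) simp
    then show ?thesis unfolding coeff_f by simp
  qed
  also have "M 0 (s + 1) (s + 1) = lam ^ (k - 1) * (- 1) ^ t"
    by (simp add: M_at_0 c degree_monom_eq)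
  finally have "coeff (f \<circ>\<^sub>p [:0, 1:]) (s + 1) \<noteq> 0"
    using lam binom by simp
  then have f_nz: "f \<noteq> 0" by auto

  have deg: "degree f \<le> k + s + t"
  proof -
    have "degree (F a) \<le> 1 * (k + s) + 1 * t" for a
      unfolding F_def
      by (intro order_trans[OF degree_mult_le] add_mono order_trans[OF degree_power_le])
        (simp_all add: degree_pCons_eq_if)
    then show ?thesis
      unfolding f_def by (intro degree_sum_le fin) (auto intro: order_trans[OF degree_smult_le])
  qed

  have "r \<le> order b f" if r: "r \<le> s + 1" and
    A: "\<forall>a\<in>A. a = b \<and> r \<le> t \<or> (a * b + lam) ^ k = 1 \<or> a * b + lam = 0 \<and> r \<le> s" for b r
  proof (rule order_ge_if_coeff_pcompose_eq_0[OF f_nz])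
    fix l assume l: "l < r"
    have "M b l h = 0" if h: "h \<le> l" "l - h \<le> t" for h
    proof -
      \<comment> \<open>\<open>P\<close> results from dropping \<open>(a * b + lam) ^ k\<close>, and
        its degree is at most \<open>s + t - (l - h)\<close>. If instead \<open>a = b\<close> or
        \<open>a * b + lam = 0\<close>, both sides are 0: the exponent \<open>t - (l - h)\<close> or
        \<open>s - h\<close> is positive because \<open>l < r\<close>.\<close>
      define P where "P = [:0, 1:] ^ h * [:lam, b:] ^ (s - h) * [:b, - 1:] ^ (t - (l - h))"
      have "M b l h = (\<Sum>a\<in>A. c a * poly P a)"
        unfolding M_def
      proof (rule sum.cong)
        fix a assume "a \<in> A"
        with A consider "a = b" "r \<le> t" | "(a * b + lam) ^ k = 1" | "a * b + lam = 0" "r \<le> s"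
          by blast
        then have "(a * b + lam) ^ (k + s - h) * (b - a) ^ (t - (l - h)) =
            (a * b + lam) ^ (s - h) * (b - a) ^ (t - (l - h))"
        proof cases
          case 1
          with l h show ?thesis by (auto simp: power_0_left)
        next
          case 2
          have "k + s - h = k + (s - h)" using l h r by simp
          with 2 show ?thesis by (simp add: power_add)
        next
          case 3
          with l h show ?thesis by (auto simp: power_0_left)
        qed
        then show "c a * (a ^ h * (a * b + lam) ^ (k + s - h) * (b - a) ^ (t - (l - h))) =
            c a * poly P a"
          by (simp add: P_def mult.assoc) (simp add: algebra_simps)
      qed simp
      also have "degree P \<le> 1 * h + 1 * (s - h) + 1 * (t - (l - h))"
        unfolding P_def
        by (intro order_trans[OF degree_mult_le] add_mono order_trans[OF degree_power_le])
          (simp_all add: degree_pCons_eq_if)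
      then have "(\<Sum>a\<in>A. c a * poly P a) = 0"
        using l h r by (intro c0) simp
      finally show ?thesis .
    qed
    then show "coeff (f \<circ>\<^sub>p [:b, 1:]) l = 0"
      unfolding coeff_f by (intro sum.neutral) (metis atMost_iff binomial_eq_0 mult_zero_left
        mult_zero_right not_le of_nat_0)
  qed
  moreover have "s + 1 \<le> order 0 f"
    using vanish_0 by (intro order_ge_if_coeff_pcompose_eq_0[OF f_nz]) simp
  ultimately show ?thesis using f_nz deg by blast
qed

section \<open>Counting zeros over the prime field\<close>

lemma of_nat_binomial_mod_ring_neq_0:
  assumes "n < CARD('p::prime_card)" "r \<le> n"
  shows "(of_nat (n choose r) :: 'p mod_ring) \<noteq> 0"
proof
  assume "(of_nat (n choose r) :: 'p mod_ring) = 0"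
  then have "CARD('p) dvd n choose r" by (rule of_nat_0_mod_ring_dvd)
  also have "n choose r dvd fact n"
    using binomial_fact_lemma[OF assms(2)] by (metis dvd_triv_right)
  finally show False
    using assms(1) prime_dvd_fact_iff[OF prime_card[where 'a = 'p]] by simp
qed

lemma dth_powers_power_eq_1:
  fixes y :: "'p::prime_card mod_ring"
  assumes "y \<in> dth_powers d" "d * k + 1 = CARD('p)"
  shows "y ^ k = 1"
proof -
  from assms(1) obtain x where x: "y = x ^ d" "x \<noteq> 0"
    by (auto simp: dth_powers_def)
  have "x * x ^ (d * k) = x ^ CARD('p mod_ring)"
    using assms(2) by (simp flip: power_Suc)
  also have "\<dots> = x" by (rule finite_field_power_card_eq_same)
  finally show ?thesis using x by (simp add: power_mult)
qed

text \<open>Case \<open>t = 0\<close>: each \<open>b\<close> in \<open>B\<close> is a zero of order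
  at least \<open>card A - 1\<close>, or one less if some \<open>a * b + lam\<close> is 0. A
  separate \<open>B\<close> makes it possible to adjoin 0 to \<open>A\<close> alone.\<close>

lemma card_mult_lt_of_mult_add_subset_roots:
  fixes A B :: "'p::prime_card mod_ring set"
  assumes k: "1 \<le> k" "2 * k < CARD('p)" and lam: "lam \<noteq> 0"
    and A: "2 \<le> card A" and B: "0 \<notin> B" "B \<noteq> {}"
    and AB: "\<And>a b. a \<in> A \<Longrightarrow> b \<in> B \<Longrightarrow> (a * b + lam) ^ k = 1 \<or> a * b + lam = 0"
  shows "(card A - 1) * card B < k + card {b \<in> B. \<exists>a\<in>A. a * b + lam = 0}"
proof -
  define s where "s = card A - 2"
  have card_A: "card A = s + 0 + 2" using A by (simp add: s_def)
  \<comment> \<open>The values \<open>a * b + lam\<close> for one fixed \<open>b\<close> are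
    distinct roots of \<open>y ^ (k + 1) - y\<close>. This gives \<open>k + s < 2 * k < p\<close>,
    so the binomial is nonzero.\<close>
  have "card A \<le> k + 1"
  proof -
    define g where "g = monom 1 (k + 1) - monom (1 :: 'p mod_ring) 1"
    obtain b where b: "b \<in> B" using B by blast
    with B have "b \<noteq> 0" by blast
    then have "card A = card ((\<lambda>a. a * b + lam) ` A)"
      by (intro card_image[symmetric]) (auto simp: inj_on_def)
    also have "(\<lambda>a. a * b + lam) ` A \<subseteq> {y. poly g y = 0}"
      using AB[OF _ b] by (auto simp: g_def poly_monom)
    then have "card ((\<lambda>a. a * b + lam) ` A) \<le> card {y. poly g y = 0}"
      by (intro card_mono) auto
    also have "coeff g (k + 1) = 1"
      using k by (simp add: g_def)
    then have "g \<noteq> 0" by auto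
    then have "card {y. poly g y = 0} \<le> degree g" by (rule card_poly_roots_bound)
    also have "degree g \<le> k + 1"
      unfolding g_def by (intro degree_diff_le) (auto intro: order_trans[OF degree_monom_le])
    finally show ?thesis .
  qed
  then have "(of_nat ((k + s) choose (s + 1)) :: 'p mod_ring) \<noteq> 0"
    using k by (intro of_nat_binomial_mod_ring_neq_0) (auto simp: s_def)
  from ex_stepanov_polynomial[OF _ card_A lam this] obtain f where
    f: "f \<noteq> 0" "degree f \<le> k + s" "s + 1 \<le> order 0 f" and
    ord: "\<And>b r. r \<le> s + 1 \<Longrightarrow>
      (\<forall>a\<in>A. a = b \<and> r \<le> 0 \<or> (a * b + lam) ^ k = 1 \<or> a * b + lam = 0 \<and> r \<le> s) \<Longrightarrow>
      r \<le> order b f"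
    by (auto simp del: le_zero_eq)
  have "(s + 1) * card B = (\<Sum>b\<in>B. s + 1)" by simp
  also have "\<dots> \<le> (\<Sum>b\<in>B. order b f + (if \<exists>a\<in>A. a * b + lam = 0 then 1 else 0))"
  proof (rule sum_mono)
    fix b assume b: "b \<in> B"
    show "s + 1 \<le> order b f + (if \<exists>a\<in>A. a * b + lam = 0 then 1 else 0)"
    proof (cases "\<exists>a\<in>A. a * b + lam = 0")
      case True
      have "s \<le> order b f" using AB b by (intro ord) auto
      with True show ?thesis by simp
    next
      case False
      have "s + 1 \<le> order b f" using AB b False by (intro ord) auto
      with False show ?thesis by simp
    qed
  qed
  also have "\<dots> = (\<Sum>b\<in>B. order b f) + card {b \<in> B. \<exists>a\<in>A. a * b + lam = 0}"
    by (simp add: sum.distrib card_eq_sum sum.inter_filter del: sum_constant One_nat_def)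
  finally have "(s + 1) * card B + order 0 f \<le>
      (\<Sum>b\<in>insert 0 B. order b f) + card {b \<in> B. \<exists>a\<in>A. a * b + lam = 0}"
    using B by simp
  also have "(\<Sum>b\<in>insert 0 B. order b f) \<le> k + s"
    using sum_order_le_degree_on[OF f(1), of "insert 0 B"] f(2) by simp
  finally show ?thesis using f(3) by (simp add: card_A)
qed

text \<open>Case \<open>s = t\<close>: the polynomial is built from only \<open>2 * t + 2\<close>
  points of \<open>A\<close>, but every point of \<open>A\<close> is a zero of order at least
  \<open>t\<close>, since neither exception costs anything up to that order.\<close>

lemma card_mult_lt_of_D_prop:
  fixes A :: "'p::prime_card mod_ring set"
  assumes k: "1 \<le> k" "2 * k < CARD('p)" and lam: "lam \<noteq> 0"
    and A: "0 \<notin> A" "2 * t + 2 \<le> card A"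
    and AA: "\<And>a b. a \<in> A \<Longrightarrow> b \<in> A \<Longrightarrow> a \<noteq> b \<Longrightarrow> (a * b + lam) ^ k = 1 \<or> a * b + lam = 0"
  shows "card A * t < k + t"
proof -
  obtain A' where A': "A' \<subseteq> A" "card A' = t + t + 2"
    using obtain_subset_with_card_n[OF A(2)] by (metis mult_2)
  have "card A \<le> CARD('p)"
    using card_mono[of UNIV A] by simp
  then have "(of_nat ((k + t) choose (t + 1)) :: 'p mod_ring) \<noteq> 0"
    using k A by (intro of_nat_binomial_mod_ring_neq_0) auto
  from ex_stepanov_polynomial[OF _ A'(2) lam this] obtain f where
    f: "f \<noteq> 0" "degree f \<le> k + t + t" "t + 1 \<le> order 0 f" and
    ord: "\<And>b r. r \<le> t + 1 \<Longrightarrow>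
      (\<forall>a\<in>A'. a = b \<and> r \<le> t \<or> (a * b + lam) ^ k = 1 \<or> a * b + lam = 0 \<and> r \<le> t) \<Longrightarrow>
      r \<le> order b f"
    by auto
  have "card A * t + (t + 1) \<le> (\<Sum>b\<in>A. order b f) + order 0 f"
  proof (rule add_mono)
    have "t \<le> order b f" if "b \<in> A" for b
      using AA A'(1) that by (intro ord) auto
    then show "card A * t \<le> (\<Sum>b\<in>A. order b f)"
      using sum_bounded_below[of A t "\<lambda>b. order b f"] by simp
  qed (rule f)
  also have "\<dots> = (\<Sum>b\<in>insert 0 A. order b f)" using A by simp
  also have "\<dots> \<le> degree f" by (rule sum_order_le_degree_on[OF f(1)]) simp
  finally show ?thesis using f(2) by simp
qed

section \<open>Extremal sets and the three bounds\<close>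

lemma MSD_attained:
  obtains A where "SD_prop d lam A" "MSD d lam = card A"
proof -
  have "MSD d lam \<in> {card A | A. SD_prop d lam A}"
    unfolding MSD_def by (rule Max_in) (auto simp: SD_prop_def)
  then show ?thesis using that by blast
qed

lemma MD_attained:
  obtains A where "D_prop d lam A" "MD d lam = card A"
proof -
  have "MD d lam \<in> {card A | A. D_prop d lam A}"
    unfolding MD_def by (rule Max_in) (auto simp: D_prop_def)
  then show ?thesis using that by blast
qed

theorem theorem1p4:
  fixes d p :: nat and lam :: "'p::prime_card mod_ring"
  assumes "d \<ge> 2"
    and "p = CARD('p)"
    and "[p = 1] (mod d)"
    and "lam \<noteq> 0"
  shows "(real (MSD d lam) \<le> sqrt ((real p - 1) / real d) + 1 \<and>
          (lam \<in> dth_powers d \<longrightarrow>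
             real (MSD d lam) \<le> sqrt ((real p - 1) / real d - 3 / 4) + 1 / 2)) \<and>
         real (MD d lam) \<le> sqrt (2 * (real p - 1) / real d) + 4"
proof -
  have "p \<ge> 2"
    using prime_ge_2_nat[OF prime_card[where 'a = 'p]] assms(2) by simp
  moreover have "d dvd p - 1"
    using assms(3) \<open>p \<ge> 2\<close> by (simp add: cong_altdef_nat)
  then obtain k where "p - 1 = d * k" ..
  ultimately have k: "p = d * k + 1" "1 \<le> k"
    by (cases k; simp)+
  have "2 * k \<le> d * k" using assms(1) by simp
  with k(1) assms(2) have k2: "2 * k < CARD('p)" by linarith
  have kr: "(real p - 1) / real d = real k" "2 * (real p - 1) / real d = 2 * real k"
    using assms(1) k(1) by (simp_all add: field_simps)
  have pow: "y ^ k = 1" if "y \<in> dth_powers d" for y :: "'p mod_ring"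
    using dth_powers_power_eq_1[OF that] k(1) assms(2) by simp

  obtain A where SD: "SD_prop d lam A" and MSD: "MSD d lam = card A"
    by (rule MSD_attained)
  from SD have A0: "0 \<notin> A" and
    AA: "\<And>a b. a \<in> A \<Longrightarrow> b \<in> A \<Longrightarrow> (a * b + lam) ^ k = 1 \<or> a * b + lam = 0"
    using pow unfolding SD_prop_def by blast+
  define n where "n = card A"
  have zeros: "card {b \<in> A. \<exists>a\<in>A'. a * b + lam = 0} \<le> n" for A'
    unfolding n_def by (rule card_mono) auto

  have "real n \<le> sqrt (real k) + 1"
  proof (cases "n \<ge> 2")
    case True
    then have "A \<noteq> {}" by (auto simp: n_def)
    with True have "(n - 1) * n < k + n"
      using card_mult_lt_of_mult_add_subset_roots[OF k(2) k2 assms(4) _ A0 _ AA] zeros[of A]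
      by (fastforce simp: n_def)
    \<comment> \<open>The previous inequality says \<open>(n - 1)^2 < k + 1\<close>.\<close>
    with True have "(n - 1) * (n - 1) \<le> k"
      by (cases n) auto
    then have "real ((n - 1) * (n - 1)) \<le> real k" by (rule of_nat_mono)
    then have "(real n - 1)\<^sup>2 \<le> real k"
      using True by (simp add: power2_eq_square of_nat_diff)
    then have "real n - 1 \<le> sqrt (real k)" by (rule real_le_rsqrt)
    then show ?thesis by simp
  next
    case False
    then show ?thesis by (simp add: add_increasing)
  qed
  moreover have "real n \<le> sqrt (real k - 3 / 4) + 1 / 2" if "lam \<in> dth_powers d"
  proof (cases "n = 0")
    case False
    then have "A \<noteq> {}" by (auto simp: n_def)
    have card: "card (insert 0 A) = n + 1" using A0 by (simp add: n_def)
    \<comment> \<open>For \<open>a = 0\<close> the value is \<open>lam\<close>, whose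
      \<open>k\<close>-th power is 1. The extra point turns the factor \<open>n - 1\<close> into
      \<open>n\<close>.\<close>
    have "(card (insert 0 A) - 1) * card A < k + card {b \<in> A. \<exists>a\<in>insert 0 A. a * b + lam = 0}"
      using k(2) k2 assms(4)
    proof (rule card_mult_lt_of_mult_add_subset_roots)
      show "2 \<le> card (insert 0 A)" using card False by simp
      show "(a * b + lam) ^ k = 1 \<or> a * b + lam = 0" if "a \<in> insert 0 A" "b \<in> A" for a b
        using that AA pow[OF \<open>lam \<in> dth_powers d\<close>] by auto
    qed fact+
    then have "n * n < k + n"
      using zeros[of "insert 0 A"] by (simp add: card n_def)
    \<comment> \<open>Integrality gives \<open>n^2 - n + 1 \<le> k\<close>; completing the square
      produces 3/4.\<close>
    then have "real (n * n + 1) \<le> real (k + n)" by (intro of_nat_mono) simp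
    then have "(real n - 1 / 2)\<^sup>2 \<le> real k - 3 / 4"
      by (simp add: power2_eq_square algebra_simps)
    then have "real n - 1 / 2 \<le> sqrt (real k - 3 / 4)" by (rule real_le_rsqrt)
    then show ?thesis by simp
  next
    case True
    then show ?thesis using k(2) by (simp add: add_increasing)
  qed
  moreover have "real (MD d lam) \<le> sqrt (2 * real k) + 4"
  proof -
    obtain B where D: "D_prop d lam B" and MD: "MD d lam = card B"
      by (rule MD_attained)
    from D have B0: "0 \<notin> B" and
      BB: "\<And>a b. a \<in> B \<Longrightarrow> b \<in> B \<Longrightarrow> a \<noteq> b \<Longrightarrow> (a * b + lam) ^ k = 1 \<or> a * b + lam = 0"
      using pow unfolding D_prop_def by blast+
    define m where "m = card B"
    have "real m \<le> sqrt (2 * real k) + 4"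
    proof (cases "m \<ge> 3")
      case True
      \<comment> \<open>The largest \<open>t\<close> for which \<open>B\<close> has
        \<open>2 * t + 2\<close> points; parity costs at most one point.\<close>
      define t where "t = (m - 2) div 2"
      have t: "2 * t + 2 \<le> m" "m \<le> 2 * t + 3" using True by (auto simp: t_def)
      with card_mult_lt_of_D_prop[OF k(2) k2 assms(4) B0 _ BB] have "m * t < k + t"
        by (simp add: m_def)
      then have "real (m * t) < real (k + t)" by (simp only: of_nat_less_iff)
      moreover have "(real m - 1) * (real m - 3) \<le> (real m - 1) * (2 * real t)"
        using True t by (intro mult_left_mono) auto
      \<comment> \<open>\<open>(m - 2)^2 = (m - 1) * (m - 3) + 1\<close>, and
        \<open>(m - 1) * t < k\<close>.\<close>
      ultimately have "(real m - 2)\<^sup>2 \<le> 2 * real k + 1"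
        by (simp add: power2_eq_square algebra_simps)
      also have "\<dots> \<le> (sqrt (2 * real k) + 1)\<^sup>2"
        by (simp add: power2_sum)
      finally have "real m - 2 \<le> sqrt (2 * real k) + 1"
        by (rule power2_le_imp_le) simp
      then show ?thesis by simp
    next
      case False
      then show ?thesis by (simp add: add_increasing)
    qed
    then show ?thesis by (simp add: MD m_def)
  qed
  ultimately show ?thesis unfolding kr MSD n_def by blast
qed

end
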